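(* Let $A, B, C$ be finite alphabets, let $\varphi : A^{*} \to C^{*}$, $\psi : B^{*} \to C^{*}$ be two epimorphisms of monoids, and let $\mathcal{A}_{\varphi,\psi}$ be the associated two-tape automaton (defined in the context). Then the fiber product $\Pi(\varphi,\psi) = \{(\alpha,\beta) \in A^{*}\times B^{*} : \varphi(\alpha) = \psi(\beta)\}$ is finitely generated (as a monoid) if and only if $\mathcal{A}_{\varphi,\psi}$ has no cycles.
   Context: For an alphabet $A$, $A^{*}$ is the free monoid over $A$ with empty word $\varepsilon_A$, and $A^{+} = A^{*}\setminus\{\varepsilon_A\}$. "Epimorphism" means surjective homomorphism. For words, $u \leq_p w$ means $u$ is a prefix of $w$; $u <_s w$ means $u$ is a suffix of $w$ with $u \ne w$; if $u \leq_p w$ then $u^{-1}w$ is the unique word $u'$ with $uu' = w$. A two-tape automaton is a tuple $(Q,\Sigma_1,\Sigma_2,\delta,\iota,F)$ with $Q$ a finite set of states, input alphabets $\Sigma_1,\Sigma_2$, transition relation $\delta \subseteq Q\times\Sigma\times Q$ where $\Sigma = (\Sigma_1\cup\{\varepsilon_1\})\times(\Sigma_2\cup\{\varepsilon_2\})$ ($\varepsilon_1,\varepsilon_2$ the empty words over $\Sigma_1, \Sigma_2$), initial state $\iota \in Q$ and set of final states $F\subseteq Q$. A cycle is a finite sequence ($k \geq 1$) of transitions $(q_{i-1},\sigma_i,q_i)_{i=1}^{k}$ in $\delta$ with $q_0 = q_k$. The automaton $\mathcal{A}_{\varphi,\psi} = (Q,\Sigma_1,\Sigma_2,\delta,\iota,F)$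 is given by: $\Sigma_1 = A$, $\Sigma_2 = B$; $Q = Q_1\cup Q_2\cup\{\iota\}\cup\{(\varepsilon_C,\varepsilon_C)\}$, where $\iota$ is a separate symbol, $Q_1 = \{(u,\varepsilon_C) : u \in C^{+},\ \exists w \in \varphi(A),\ u <_s w\}$, $Q_2 = \{(\varepsilon_C,v) : v \in C^{+},\ \exists w\in\psi(B),\ v <_s w\}$; $F = \{(\varepsilon_C,\varepsilon_C)\}$; and $\delta = \bigcup_{i=1}^{8}\Delta_i \subseteq Q\times\Sigma\times Q$, where $\Delta_1 = \{(\iota,(a,\varepsilon_B),(\varepsilon_C,\varepsilon_C)) : a\in A,\ \varphi(a)=\varepsilon_C\}$; $\Delta_2 = \{(\iota,(\varepsilon_A,b),(\varepsilon_C,\varepsilon_C)) : b\in B,\ \psi(b)=\varepsilon_C\}$; $\Delta_3 = \{(\iota,(a,b),(\psi(b)^{-1}\varphi(a),\varepsilon_C)) : a\in A, b\in B,\ \psi(b)\leq_p\varphi(a),\ \psi(b)\neq\varepsilon_C\}$; $\Delta_4 = \{(\iota,(a,b),(\varepsilon_C,\varphi(a)^{-1}\psi(b))) : a\in A, b\in B,\ \varphi(a)\leq_p\psi(b),\ \varphi(a)\neq\varepsilon_C\}$; $\Delta_5 = \{((u,\varepsilon_C),(\varepsilon_A,b),(\psi(b)^{-1}u,\varepsilon_C)) : b\in B,\ u\neq\varepsilon_C,\ \psi(b)\leq_p u\}$; $\Delta_6 = \{((u,\varepsilon_C),(\varepsilon_A,b),(\varepsilon_C,u^{-1}\psi(b)))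 : b\in B,\ u\neq\varepsilon_C,\ u\leq_p\psi(b)\}$; $\Delta_7 = \{((\varepsilon_C,v),(a,\varepsilon_B),(\varepsilon_C,\varphi(a)^{-1}v)) : a\in A,\ v\neq\varepsilon_C,\ \varphi(a)\leq_p v\}$; $\Delta_8 = \{((\varepsilon_C,v),(a,\varepsilon_B),(v^{-1}\varphi(a),\varepsilon_C)) : a\in A,\ v\neq\varepsilon_C,\ v\leq_p\varphi(a)\}$ (in $\Delta_5,\Delta_6$ the pair $(u,\varepsilon_C)$ ranges over $Q_1$; in $\Delta_7,\Delta_8$ the pair $(\varepsilon_C,v)$ ranges over $Q_2$). *)

theory Defs
  imports "HOL-Algebra.Group" "HOL-Library.Sublist"
begin

subsection \<open>Free monoids, epimorphisms, finite generation\<close>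

definition free_monoid :: "'a set \<Rightarrow> 'a list monoid" where
  "free_monoid A = \<lparr>carrier = lists A, mult = (@), one = []\<rparr>"

text \<open>Library homomorphisms (\<^const>\<open>hom\<close>, \<^const>\<open>epi\<close>) are only required to respect
  multiplication, so preservation of the unit is added.\<close>

definition monoid_epi ::
    "('a, 'm) monoid_scheme \<Rightarrow> ('b, 'n) monoid_scheme \<Rightarrow> ('a \<Rightarrow> 'b) set" where
  "monoid_epi M N = {h \<in> epi M N. h \<one>\<^bsub>M\<^esub> = \<one>\<^bsub>N\<^esub>}"

inductive_set submonoid_generated :: "('a, 'm) monoid_scheme \<Rightarrow> 'a set \<Rightarrow> 'a set"
  for M :: "('a, 'm) monoid_scheme" and S :: "'a set" where
  one: "\<one>\<^bsub>M\<^esub> \<in> submonoid_generated M S"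
| incl: "x \<in> S \<Longrightarrow> x \<in> submonoid_generated M S"
| mult: "x \<in> submonoid_generated M S \<Longrightarrow> y \<in> submonoid_generated M S
    \<Longrightarrow> x \<otimes>\<^bsub>M\<^esub> y \<in> submonoid_generated M S"

definition finitely_generated_monoid :: "('a, 'm) monoid_scheme \<Rightarrow> bool" where
  "finitely_generated_monoid M \<longleftrightarrow>
     (\<exists>S. finite S \<and> S \<subseteq> carrier M \<and> submonoid_generated M S = carrier M)"

definition fiber_product ::
    "'a set \<Rightarrow> 'b set \<Rightarrow> ('a list \<Rightarrow> 'c list) \<Rightarrow> ('b list \<Rightarrow> 'c list) \<Rightarrow> ('a list \<times> 'b list) monoid" where
  "fiber_product A B \<phi> \<psi> = (free_monoid A \<times>\<times> free_monoid B)
     \<lparr>carrier := {(\<alpha>, \<beta>). \<alpha> \<in> lists A \<and> \<beta> \<in> lists B \<and> \<phi> \<alpha> = \<psi> \<beta>}\<rparr>"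


subsection \<open>Two-tape automata\<close>

text \<open>A transition label is a pair of words of length at most one, the empty word
  standing for \<open>\<epsilon>\<^sub>1\<close> resp. \<open>\<epsilon>\<^sub>2\<close>.\<close>

type_synonym ('q, 'a, 'b) transition = "'q \<times> ('a list \<times> 'b list) \<times> 'q"

record ('q, 'a, 'b) two_tape_automaton =
  states :: "'q set"
  alphabet1 :: "'a set"
  alphabet2 :: "'b set"
  transitions :: "('q, 'a, 'b) transition set"
  initial :: 'q
  final :: "'q set"

definition tape_labels :: "'a set \<Rightarrow> 'b set \<Rightarrow> ('a list \<times> 'b list) set" where
  "tape_labels A B = ({[a] | a. a \<in> A} \<union> {[]}) \<times> ({[b] | b. b \<in> B} \<union> {[]})"

locale two_tape_automaton =
  fixes \<A> :: "('q, 'a, 'b) two_tape_automaton"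
  assumes finite_states: "finite (states \<A>)"
    and finite_alphabet1: "finite (alphabet1 \<A>)"
    and finite_alphabet2: "finite (alphabet2 \<A>)"
    and transitions_subset:
      "transitions \<A> \<subseteq> states \<A> \<times> tape_labels (alphabet1 \<A>) (alphabet2 \<A>) \<times> states \<A>"
    and initial_state: "initial \<A> \<in> states \<A>"
    and final_subset: "final \<A> \<subseteq> states \<A>"

definition is_cycle ::
    "('q, 'a, 'b) two_tape_automaton \<Rightarrow> nat \<Rightarrow> (nat \<Rightarrow> 'q) \<Rightarrow> (nat \<Rightarrow> 'a list \<times> 'b list) \<Rightarrow> bool" where
  "is_cycle \<A> k q \<sigma> \<longleftrightarrow>
     k \<ge> 1 \<and> (\<forall>i\<in>{1..k}. (q (i - 1), \<sigma> i, q i) \<in> transitions \<A>) \<and> q 0 = q k"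

definition has_cycle :: "('q, 'a, 'b) two_tape_automaton \<Rightarrow> bool" where
  "has_cycle \<A> \<longleftrightarrow> (\<exists>k q \<sigma>. is_cycle \<A> k q \<sigma>)"


subsection \<open>The automaton associated with a pair of homomorphisms\<close>

text \<open>\<^const>\<open>prefix\<close> is \<open>\<le>\<^sub>p\<close> and \<^const>\<open>strict_suffix\<close> is \<open><\<^sub>s\<close>.  The word
  \<open>u\<^sup>-\<^sup>1w\<close> is meaningful only if \<open>u\<close> is a prefix of \<open>w\<close>, and is used only then.\<close>

definition left_quotient :: "'c list \<Rightarrow> 'c list \<Rightarrow> 'c list" where
  "left_quotient u w = drop (length u) w"

lemma left_quotient_iff: "prefix u w \<Longrightarrow> u @ u' = w \<longleftrightarrow> u' = left_quotient u w"
  by (auto simp: left_quotient_def prefix_def)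

datatype 'c state = Start | Pair "'c list" "'c list"

definition Q1 :: "'a set \<Rightarrow> 'c set \<Rightarrow> ('a list \<Rightarrow> 'c list) \<Rightarrow> 'c state set" where
  "Q1 A C \<phi> = {Pair u [] | u. u \<in> lists C - {[]} \<and> (\<exists>a\<in>A. strict_suffix u (\<phi> [a]))}"

definition Q2 :: "'b set \<Rightarrow> 'c set \<Rightarrow> ('b list \<Rightarrow> 'c list) \<Rightarrow> 'c state set" where
  "Q2 B C \<psi> = {Pair [] v | v. v \<in> lists C - {[]} \<and> (\<exists>b\<in>B. strict_suffix v (\<psi> [b]))}"

context
  fixes A :: "'a set" and B :: "'b set" and C :: "'c set"
    and \<phi> :: "'a list \<Rightarrow> 'c list" and \<psi> :: "'b list \<Rightarrow> 'c list"
begin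

definition \<Delta>1 :: "('c state, 'a, 'b) transition set" where
  "\<Delta>1 = {(Start, ([a], []), Pair [] []) | a. a \<in> A \<and> \<phi> [a] = []}"

definition \<Delta>2 :: "('c state, 'a, 'b) transition set" where
  "\<Delta>2 = {(Start, ([], [b]), Pair [] []) | b. b \<in> B \<and> \<psi> [b] = []}"

definition \<Delta>3 :: "('c state, 'a, 'b) transition set" where
  "\<Delta>3 = {(Start, ([a], [b]), Pair (left_quotient (\<psi> [b]) (\<phi> [a])) []) | a b.
     a \<in> A \<and> b \<in> B \<and> prefix (\<psi> [b]) (\<phi> [a]) \<and> \<psi> [b] \<noteq> []}"

definition \<Delta>4 :: "('c state, 'a, 'b) transition set" where
  "\<Delta>4 = {(Start, ([a], [b]), Pair [] (left_quotient (\<phi> [a]) (\<psi> [b]))) | a b.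
     a \<in> A \<and> b \<in> B \<and> prefix (\<phi> [a]) (\<psi> [b]) \<and> \<phi> [a] \<noteq> []}"

definition \<Delta>5 :: "('c state, 'a, 'b) transition set" where
  "\<Delta>5 = {(Pair u [], ([], [b]), Pair (left_quotient (\<psi> [b]) u) []) | u b.
     Pair u [] \<in> Q1 A C \<phi> \<and> b \<in> B \<and> u \<noteq> [] \<and> prefix (\<psi> [b]) u}"

definition \<Delta>6 :: "('c state, 'a, 'b) transition set" where
  "\<Delta>6 = {(Pair u [], ([], [b]), Pair [] (left_quotient u (\<psi> [b]))) | u b.
     Pair u [] \<in> Q1 A C \<phi> \<and> b \<in> B \<and> u \<noteq> [] \<and> prefix u (\<psi> [b])}"

definition \<Delta>7 :: "('c state, 'a, 'b) transition set" where
  "\<Delta>7 = {(Pair [] v, ([a], []), Pair [] (left_quotient (\<phi> [a]) v)) | v a.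
     Pair [] v \<in> Q2 B C \<psi> \<and> a \<in> A \<and> v \<noteq> [] \<and> prefix (\<phi> [a]) v}"

definition \<Delta>8 :: "('c state, 'a, 'b) transition set" where
  "\<Delta>8 = {(Pair [] v, ([a], []), Pair (left_quotient v (\<phi> [a])) []) | v a.
     Pair [] v \<in> Q2 B C \<psi> \<and> a \<in> A \<and> v \<noteq> [] \<and> prefix v (\<phi> [a])}"

definition assoc_automaton :: "('c state, 'a, 'b) two_tape_automaton" where
  "assoc_automaton =
     \<lparr>states = Q1 A C \<phi> \<union> Q2 B C \<psi> \<union> {Start} \<union> {Pair [] []},
      alphabet1 = A,
      alphabet2 = B,
      transitions = \<Delta>1 \<union> \<Delta>2 \<union> \<Delta>3 \<union> \<Delta>4 \<union> \<Delta>5 \<union> \<Delta>6 \<union> \<Delta>7 \<union> \<Delta>8,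
      initial = Start,
      final = {Pair [] []}\<rparr>"

end


subsection \<open>Well-formedness\<close>

lemma monoid_free_monoid: "monoid (free_monoid A)"
  by unfold_locales (auto simp: free_monoid_def)

lemma monoid_epi_in_lists:
  assumes "h \<in> monoid_epi (free_monoid A) (free_monoid C)" "x \<in> lists A"
  shows "h x \<in> lists C"
  using assms by (auto simp: monoid_epi_def epi_def free_monoid_def)

lemma monoid_fiber_product:
  assumes "\<phi> \<in> monoid_epi (free_monoid A) (free_monoid C)"
    and "\<psi> \<in> monoid_epi (free_monoid B) (free_monoid C)"
  shows "monoid (fiber_product A B \<phi> \<psi>)"
proof -
  have "\<phi> (x @ y) = \<phi> x @ \<phi> y" if "x \<in> lists A" "y \<in> lists A" for x y
    using assms(1) that by (auto simp: monoid_epi_def epi_def hom_def free_monoid_def)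
  moreover have "\<psi> (x @ y) = \<psi> x @ \<psi> y" if "x \<in> lists B" "y \<in> lists B" for x y
    using assms(2) that by (auto simp: monoid_epi_def epi_def hom_def free_monoid_def)
  moreover have "\<phi> [] = []" "\<psi> [] = []"
    using assms by (auto simp: monoid_epi_def free_monoid_def)
  ultimately show ?thesis
    by unfold_locales
      (auto simp: fiber_product_def DirProd_def free_monoid_def in_lists_conv_set[symmetric]
        simp del: in_lists_conv_set)
qed

lemma finite_proper_suffixes:
  assumes "finite A"
  shows "finite {u. \<exists>a\<in>A. strict_suffix u (h a)}"
proof -
  have "{u. \<exists>a\<in>A. strict_suffix u (h a)} \<subseteq> (\<Union>a\<in>A. set (suffixes (h a)))"
    by (auto simp: strict_suffix_def)
  then show ?thesis using assms by (meson List.finite_set finite_UN_I finite_subset)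
qed

lemma strict_suffix_left_quotient:
  assumes "prefix u w" "u \<noteq> []"
  shows "strict_suffix (left_quotient u w) w"
  using assms by (auto simp: prefix_def left_quotient_def strict_suffix_def suffix_def)

lemma suffix_left_quotient:
  assumes "prefix u w"
  shows "suffix (left_quotient u w) w"
  using assms by (auto simp: prefix_def left_quotient_def suffix_def)

lemma two_tape_automaton_assoc_automaton:
  assumes fin: "finite A" "finite B"
    and \<phi>: "\<phi> \<in> monoid_epi (free_monoid A) (free_monoid C)"
    and \<psi>: "\<psi> \<in> monoid_epi (free_monoid B) (free_monoid C)"
  shows "two_tape_automaton (assoc_automaton A B C \<phi> \<psi>)"
proof
  let ?M = "assoc_automaton A B C \<phi> \<psi>"
  have "Q1 A C \<phi> \<subseteq> (\<lambda>u. Pair u []) ` {u. \<exists>a\<in>A. strict_suffix u (\<phi> [a])}"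
    "Q2 B C \<psi> \<subseteq> (\<lambda>v. Pair [] v) ` {v. \<exists>b\<in>B. strict_suffix v (\<psi> [b])}"
    by (auto simp: Q1_def Q2_def)
  then have "finite (Q1 A C \<phi>)" "finite (Q2 B C \<psi>)"
    using finite_proper_suffixes[OF fin(1), of "\<lambda>a. \<phi> [a]"]
      finite_proper_suffixes[OF fin(2), of "\<lambda>b. \<psi> [b]"]
    by (meson finite_imageI finite_subset)+
  then show "finite (states ?M)"
    by (simp add: assoc_automaton_def)
  have \<phi>C: "\<phi> [a] \<in> lists C" if "a \<in> A" for a
    using monoid_epi_in_lists[OF \<phi>] that by simp
  have \<psi>C: "\<psi> [b] \<in> lists C" if "b \<in> B" for b
    using monoid_epi_in_lists[OF \<psi>] that by simp
  have sub: "u \<in> lists C" if "suffix u w" "w \<in> lists C" for u w :: "'c list"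
    using that by (auto simp: suffix_def)
  have 1: "Pair u [] \<in> states ?M" if "a \<in> A" "strict_suffix u (\<phi> [a])" for a u
    using that sub[OF _ \<phi>C] by (auto simp: assoc_automaton_def Q1_def strict_suffix_def)
  have 2: "Pair [] v \<in> states ?M" if "b \<in> B" "strict_suffix v (\<psi> [b])" for b v
    using that sub[OF _ \<psi>C] by (auto simp: assoc_automaton_def Q2_def strict_suffix_def)
  have 0: "Start \<in> states ?M" "Pair [] [] \<in> states ?M" "Q1 A C \<phi> \<subseteq> states ?M" "Q2 B C \<psi> \<subseteq> states ?M"
    by (auto simp: assoc_automaton_def)
  let ?T = "states ?M \<times> tape_labels A B \<times> states ?M"
  note lq = strict_suffix_left_quotient suffix_left_quotient
  have "\<Delta>1 A \<phi> \<subseteq> ?T" "\<Delta>2 B \<psi> \<subseteq> ?T"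
    using 0 by (auto simp: \<Delta>1_def \<Delta>2_def tape_labels_def)
  moreover have "\<Delta>3 A B \<phi> \<psi> \<subseteq> ?T" "\<Delta>4 A B \<phi> \<psi> \<subseteq> ?T"
    using 0 by (auto simp: \<Delta>3_def \<Delta>4_def tape_labels_def intro: 1 2 lq)
  moreover have "\<Delta>6 A B C \<phi> \<psi> \<subseteq> ?T" "\<Delta>8 A B C \<phi> \<psi> \<subseteq> ?T"
    using 0 by (auto simp: \<Delta>6_def \<Delta>8_def tape_labels_def intro: 1 2 lq)
  moreover have "\<Delta>5 A B C \<phi> \<psi> \<subseteq> ?T"
  proof -
    have "Pair (left_quotient (\<psi> [b]) u) [] \<in> states ?M"
      if "Pair u [] \<in> Q1 A C \<phi>" "prefix (\<psi> [b]) u" for u b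
      using that suffix_left_quotient[OF that(2)]
      by (auto simp: Q1_def intro: 1 dest: suffix_order.le_less_trans)
    then show ?thesis using 0 by (auto simp: \<Delta>5_def tape_labels_def)
  qed
  moreover have "\<Delta>7 A B C \<phi> \<psi> \<subseteq> ?T"
  proof -
    have "Pair [] (left_quotient (\<phi> [a]) v) \<in> states ?M"
      if "Pair [] v \<in> Q2 B C \<psi>" "prefix (\<phi> [a]) v" for v a
      using that suffix_left_quotient[OF that(2)]
      by (auto simp: Q2_def intro: 2 dest: suffix_order.le_less_trans)
    then show ?thesis using 0 by (auto simp: \<Delta>7_def tape_labels_def)
  qed
  ultimately show "transitions ?M \<subseteq> states ?M \<times> tape_labels (alphabet1 ?M) (alphabet2 ?M) \<times> states ?M"
    by (simp add: assoc_automaton_def)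
qed (use fin in \<open>auto simp: assoc_automaton_def\<close>)

end

theory Submission
  imports Defs
begin

text \<open>The automaton reads a pair \<open>(\<alpha>, \<beta>)\<close> letter by letter and remembers by how much the image
  of the part read on one tape exceeds the image of the part read on the other.  A run from
  \<^const>\<open>Start\<close> to \<open>Pair [] []\<close> thus reads an element of the fiber product, and stops the first
  time the two images agree.  Therefore the labels of accepting runs

  \<^item> generate the fiber product: any pair with equal images can be read until the overhang first
    vanishes, which splits off a nontrivial label, and one recurses on the rest
    (\<open>fiber_product_generated_by_accepted\<close>);

  \<^item> are indecomposable: a factorization into two elements of the fiber product would be a moment
    strictly inside the run at which the images agree (\<open>accepted_indecomposable\<close>).

  Indecomposable elements belong to every generating set, so the fiber product is finitely
  generated iff the set of labels of accepting runs is finite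
  (\<open>finitely_generated_iff_finite_accepted\<close>).  A finite automaton without cycles has only finitely
  many runs.  Conversely, every state with a nonempty overhang is accessible and co-accessible: by
  surjectivity every letter of \<open>C\<close> is the image of a single letter on either tape, so that any
  such overhang can be produced and consumed one letter at a time.  A cycle only visits states
  with a nonempty overhang and reads at least one letter in each transition.  It can therefore be
  pumped inside accepting runs to give arbitrarily long accepted labels
  (\<open>finite_accepted_iff_no_cycle\<close>).\<close>


section \<open>Indecomposable elements of a monoid\<close>

definition indecomposable :: "('a, 'm) monoid_scheme \<Rightarrow> 'a \<Rightarrow> bool" where
  "indecomposable M x \<longleftrightarrow> x \<noteq> \<one>\<^bsub>M\<^esub> \<and>
     (\<forall>y\<in>carrier M. \<forall>z\<in>carrier M. x = y \<otimes>\<^bsub>M\<^esub> z \<longrightarrow> y = \<one>\<^bsub>M\<^esub> \<or> z = \<one>\<^bsub>M\<^esub>)"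

lemma (in monoid) submonoid_generated_subset_carrier:
  assumes "S \<subseteq> carrier G" "x \<in> submonoid_generated G S"
  shows "x \<in> carrier G"
  using assms(2) by induction (use assms(1) in auto)

lemma (in monoid) indecomposable_in_generators:
  assumes "S \<subseteq> carrier G" "x \<in> submonoid_generated G S" "indecomposable G x"
  shows "x \<in> S"
  using assms(2,3)
proof induction
  case one
  then show ?case by (simp add: indecomposable_def)
next
  case (mult x y)
  have car: "x \<in> carrier G" "y \<in> carrier G"
    using mult.hyps submonoid_generated_subset_carrier[OF assms(1)] by auto
  then have "x = \<one> \<or> y = \<one>"
    using mult.prems by (auto simp: indecomposable_def)
  then show ?case using mult car by auto
qed


section \<open>Runs and cycles of two-tape automata\<close>

inductive run :: "('q, 'a, 'b) two_tape_automaton \<Rightarrow> 'q \<Rightarrow> 'a list \<Rightarrow> 'b list \<Rightarrow> 'q \<Rightarrow> bool"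
  for M where
  refl: "run M p [] [] p"
| step: "(p, (x, y), r) \<in> transitions M \<Longrightarrow> run M r \<alpha> \<beta> q \<Longrightarrow> run M p (x @ \<alpha>) (y @ \<beta>) q"

lemma run_trans: "run M p \<alpha> \<beta> r \<Longrightarrow> run M r \<gamma> \<delta> q \<Longrightarrow> run M p (\<alpha> @ \<gamma>) (\<beta> @ \<delta>) q"
proof (induction rule: run.induct)
  case (step p x y r' \<alpha> \<beta> r)
  then show ?case using run.step[OF step.hyps(1) step.IH] by simp
qed simp

definition edges :: "('q, 'a, 'b) two_tape_automaton \<Rightarrow> ('q \<times> 'q) set" where
  "edges M = {(p, q). \<exists>\<sigma>. (p, \<sigma>, q) \<in> transitions M}"

lemma has_cycle_iff_not_acyclic: "has_cycle M \<longleftrightarrow> \<not> acyclic (edges M)"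
proof -
  have "(\<exists>q \<sigma>. is_cycle M k q \<sigma>) \<longleftrightarrow> k > 0 \<and> (\<exists>p. (p, p) \<in> edges M ^^ k)" for k
  proof
    assume "\<exists>q \<sigma>. is_cycle M k q \<sigma>"
    then obtain q \<sigma> where k: "k \<ge> 1" and q: "q 0 = q k"
      and tr: "\<And>i. i \<in> {1..k} \<Longrightarrow> (q (i - 1), \<sigma> i, q i) \<in> transitions M"
      unfolding is_cycle_def by blast
    have "(q i, q (Suc i)) \<in> edges M" if "i < k" for i
      using tr[of "Suc i"] that by (auto simp: edges_def simp del: split_paired_Ex)
    then show "k > 0 \<and> (\<exists>p. (p, p) \<in> edges M ^^ k)"
      using k q by (auto simp: relpow_fun_conv intro!: exI[of _ "q k"] exI[of _ q])
  next
    assume R: "k > 0 \<and> (\<exists>p. (p, p) \<in> edges M ^^ k)"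
    then obtain q where q: "q 0 = q k" "\<And>i. i < k \<Longrightarrow> (q i, q (Suc i)) \<in> edges M"
      unfolding relpow_fun_conv by metis
    then have "\<forall>i. \<exists>\<sigma>. i < k \<longrightarrow> (q i, \<sigma>, q (Suc i)) \<in> transitions M"
      by (auto simp: edges_def simp del: split_paired_Ex)
    then obtain \<sigma> where \<sigma>: "\<And>i. i < k \<Longrightarrow> (q i, \<sigma> i, q (Suc i)) \<in> transitions M"
      by metis
    have "(q (i - 1), \<sigma> (i - 1), q i) \<in> transitions M" if "i \<in> {1..k}" for i
      using \<sigma>[of "i - 1"] that by auto
    then have "is_cycle M k q (\<lambda>i. \<sigma> (i - 1))"
      using R q(1) by (auto simp: is_cycle_def)
    then show "\<exists>q \<sigma>. is_cycle M k q \<sigma>" by blast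
  qed
  then have "has_cycle M \<longleftrightarrow> (\<exists>p k. k > 0 \<and> (p, p) \<in> edges M ^^ k)"
    unfolding has_cycle_def by blast
  then show ?thesis
    by (simp add: acyclic_def trancl_power)
qed

text \<open>Without cycles the transition relation is well-founded in the direction of reading, and by
  well-founded induction on the starting state there are finitely many continuations after each
  of the finitely many first transitions.\<close>

lemma (in two_tape_automaton) finite_labels_of_runs:
  assumes "\<not> has_cycle \<A>"
  shows "finite {(\<alpha>, \<beta>). run \<A> p \<alpha> \<beta> q}"
proof -
  have "finite (tape_labels (alphabet1 \<A>) (alphabet2 \<A>))"
    using finite_alphabet1 finite_alphabet2 by (simp add: tape_labels_def)
  then have fin: "finite (transitions \<A>)"
    using finite_states transitions_subset by (meson finite_SigmaI finite_subset)
  have "edges \<A> = (\<lambda>(p, \<sigma>, q). (p, q)) ` transitions \<A>"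
    by (force simp: edges_def)
  then have "wf ((edges \<A>)\<inverse>)"
    using fin assms by (simp add: has_cycle_iff_not_acyclic finite_acyclic_wf_converse)
  then show ?thesis
  proof (induction p)
    case (less p)
    let ?next = "\<lambda>(p', (x, y), r). if p' = p
      then (\<lambda>(\<alpha>, \<beta>). (x @ \<alpha>, y @ \<beta>)) ` {(\<alpha>, \<beta>). run \<A> r \<alpha> \<beta> q} else {}"
    have "finite (?next t)" if "t \<in> transitions \<A>" for t
      using that less by (auto simp: edges_def split: prod.splits)
    then have "finite ({([], [])} \<union> (\<Union>t\<in>transitions \<A>. ?next t))"
      using fin by blast
    moreover have "{(\<alpha>, \<beta>). run \<A> p \<alpha> \<beta> q} \<subseteq> {([], [])} \<union> (\<Union>t\<in>transitions \<A>. ?next t)"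
    proof -
      have "(\<alpha>, \<beta>) \<in> {([], [])} \<union> (\<Union>t\<in>transitions \<A>. ?next t)"
        if "run \<A> p \<alpha> \<beta> q" for \<alpha> \<beta>
        using that
      proof (cases rule: run.cases)
        case (step x y r \<alpha>' \<beta>')
        then have "(\<alpha>, \<beta>) \<in> ?next (p, (x, y), r)" by auto
        then show ?thesis using step(3) by blast
      qed simp
      then show ?thesis by blast
    qed
    ultimately show ?case by (rule finite_subset[rotated])
  qed
qed

text \<open>Transitions labelled by a pair of empty words have to be excluded for long paths to read long
  labels.\<close>

lemma relpow_edges_run:
  assumes "\<And>p q. (p, ([], []), q) \<notin> transitions M"
  shows "(p, q) \<in> edges M ^^ n \<Longrightarrow> \<exists>\<alpha> \<beta>. run M p \<alpha> \<beta> q \<and> n \<le> length \<alpha> + length \<beta>"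
proof (induction n arbitrary: p)
  case 0
  then show ?case by (auto intro: run.refl)
next
  case (Suc n)
  from Suc.prems obtain r where "(p, r) \<in> edges M" "(r, q) \<in> edges M ^^ n"
    by (meson relpow_Suc_D2)
  then obtain x y \<alpha> \<beta> where t: "(p, (x, y), r) \<in> transitions M"
    and ab: "run M r \<alpha> \<beta> q" "n \<le> length \<alpha> + length \<beta>"
    using Suc.IH[of r] by (auto simp: edges_def)
  have "x \<noteq> [] \<or> y \<noteq> []" using t assms by blast
  then have "Suc n \<le> length (x @ \<alpha>) + length (y @ \<beta>)"
    using ab(2) by (cases x; cases y) auto
  then show ?case using run.step[OF t ab(1)] by blast
qed

lemma pump_cycle:
  assumes "\<And>p q. (p, ([], []), q) \<notin> transitions M" and "(p, p) \<in> (edges M)\<^sup>+"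
  shows "\<exists>\<alpha> \<beta>. run M p \<alpha> \<beta> p \<and> n \<le> length \<alpha> + length \<beta>"
proof -
  obtain k where k: "k > 0" "(p, p) \<in> edges M ^^ k"
    using assms(2) by (auto simp: trancl_power)
  have "(p, p) \<in> edges M ^^ (n * k)"
  proof (induction n)
    case (Suc n)
    then show ?case using k(2) by (auto simp: relpow_add simp del: relpow.simps)
  qed simp
  moreover have "n \<le> n * k" using k(1) by simp
  moreover obtain \<alpha> \<beta> where "run M p \<alpha> \<beta> p" "n * k \<le> length \<alpha> + length \<beta>"
    using relpow_edges_run[OF assms(1) calculation(1)] by blast
  ultimately show ?thesis by (meson le_trans)
qed


section \<open>Homomorphisms determined by the images of letters\<close>

text \<open>Coincides with \<open>h\<close> on the free monoid if \<open>h\<close> is a homomorphism there, but obeys the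
  homomorphism law on all lists.\<close>

definition letterwise :: "('a list \<Rightarrow> 'c list) \<Rightarrow> 'a list \<Rightarrow> 'c list" where
  "letterwise h w = concat (map (\<lambda>x. h [x]) w)"

lemma letterwise_simps [simp]:
  "letterwise h [] = []" "letterwise h (x # w) = h [x] @ letterwise h w"
  "letterwise h (v @ w) = letterwise h v @ letterwise h w"
  by (simp_all add: letterwise_def)

lemma monoid_epi_letterwise:
  assumes "h \<in> monoid_epi (free_monoid A) (free_monoid C)" "w \<in> lists A"
  shows "h w = letterwise h w"
  using assms(2)
proof induction
  case Nil
  then show ?case using assms(1) by (simp add: monoid_epi_def free_monoid_def)
next
  case (Cons x w)
  have "h \<in> hom (free_monoid A) (free_monoid C)"
    using assms(1) by (simp add: monoid_epi_def epi_def)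
  from hom_mult[OF this, of "[x]" w] have "h (x # w) = h [x] @ h w"
    using Cons.hyps by (simp add: free_monoid_def)
  then show ?case using Cons.IH by simp
qed

lemma letterwise_singletonD: "letterwise h w = [c] \<Longrightarrow> \<exists>x\<in>set w. h [x] = [c]"
proof (induction w)
  case (Cons x w)
  from Cons.prems consider "h [x] = []" "letterwise h w = [c]" | "h [x] = [c]"
    by (auto simp: append_eq_Cons_conv)
  then show ?case using Cons.IH by cases (meson list.set_intros)+
qed simp

text \<open>A preimage of a one-letter word consists of erased letters and one letter mapped to it.\<close>

lemma monoid_epi_letter_preimage:
  assumes "h \<in> monoid_epi (free_monoid A) (free_monoid C)" "c \<in> C"
  obtains a where "a \<in> A" "h [a] = [c]"
proof -
  have "h ` lists A = lists C"
    using assms(1) by (simp add: monoid_epi_def epi_def free_monoid_def)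
  moreover have "[c] \<in> lists C" using assms(2) by simp
  ultimately obtain w where w: "w \<in> lists A" "h w = [c]" by (metis imageE)
  then have "letterwise h w = [c]"
    using monoid_epi_letterwise[OF assms(1), of w] by simp
  from letterwise_singletonD[OF this] obtain a where "a \<in> set w" "h [a] = [c]"
    by blast
  then show ?thesis using w(1) that by auto
qed


section \<open>The automaton of a pair of epimorphisms\<close>

locale epi_pair =
  fixes A :: "'a set" and B :: "'b set" and C :: "'c set"
    and \<phi> :: "'a list \<Rightarrow> 'c list" and \<psi> :: "'b list \<Rightarrow> 'c list"
  assumes finite_A: "finite A" and finite_B: "finite B"
    and epi_\<phi>: "\<phi> \<in> monoid_epi (free_monoid A) (free_monoid C)"
    and epi_\<psi>: "\<psi> \<in> monoid_epi (free_monoid B) (free_monoid C)"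
begin

abbreviation M :: "('c state, 'a, 'b) two_tape_automaton" where
  "M \<equiv> assoc_automaton A B C \<phi> \<psi>"

abbreviation P :: "('a list \<times> 'b list) monoid" where
  "P \<equiv> fiber_product A B \<phi> \<psi>"

sublocale two_tape_automaton M
  rewrites "alphabet1 M = A" and "alphabet2 M = B"
  using two_tape_automaton_assoc_automaton[OF finite_A finite_B epi_\<phi> epi_\<psi>]
  by (simp_all add: assoc_automaton_def)

lemma mult_P [simp]: "(\<alpha>, \<beta>) \<otimes>\<^bsub>P\<^esub> (\<gamma>, \<delta>) = (\<alpha> @ \<gamma>, \<beta> @ \<delta>)"
  and one_P [simp]: "\<one>\<^bsub>P\<^esub> = ([], [])"
  by (simp_all add: fiber_product_def DirProd_def free_monoid_def)

lemma carrier_P: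
  "(\<alpha>, \<beta>) \<in> carrier P \<longleftrightarrow>
     \<alpha> \<in> lists A \<and> \<beta> \<in> lists B \<and> letterwise \<phi> \<alpha> = letterwise \<psi> \<beta>"
proof -
  have "(\<alpha>, \<beta>) \<in> carrier P \<longleftrightarrow> \<alpha> \<in> lists A \<and> \<beta> \<in> lists B \<and> \<phi> \<alpha> = \<psi> \<beta>"
    by (simp add: fiber_product_def)
  then show ?thesis
    using monoid_epi_letterwise[OF epi_\<phi>, of \<alpha>] monoid_epi_letterwise[OF epi_\<psi>, of \<beta>]
    by metis
qed

lemma transitions_M:
  "transitions M = \<Delta>1 A \<phi> \<union> \<Delta>2 B \<psi> \<union> \<Delta>3 A B \<phi> \<psi> \<union> \<Delta>4 A B \<phi> \<psi> \<union> \<Delta>5 A B C \<phi> \<psi>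
     \<union> \<Delta>6 A B C \<phi> \<psi> \<union> \<Delta>7 A B C \<phi> \<psi> \<union> \<Delta>8 A B C \<phi> \<psi>"
  by (simp add: assoc_automaton_def)

lemmas \<Delta>_defs = \<Delta>1_def \<Delta>2_def \<Delta>3_def \<Delta>4_def \<Delta>5_def \<Delta>6_def \<Delta>7_def \<Delta>8_def

lemma no_empty_label: "(p, ([], []), q) \<notin> transitions M"
  by (auto simp: transitions_M \<Delta>_defs)

lemma transition_to_Pair:
  assumes "(p, \<sigma>, q) \<in> transitions M"
  shows "\<exists>u v. q = Pair u v"
  using assms by (auto simp: transitions_M \<Delta>_defs)

lemma final_no_transition: "(Pair [] [], \<sigma>, q) \<notin> transitions M"
  by (auto simp: transitions_M \<Delta>_defs)

lemma state_cases:
  assumes "Pair u v \<in> states M"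
  obtains "u = []" "v = []"
  | "v = []" "u \<noteq> []" "Pair u [] \<in> Q1 A C \<phi>"
  | "u = []" "v \<noteq> []" "Pair [] v \<in> Q2 B C \<psi>"
  using assms by (auto simp: assoc_automaton_def Q1_def Q2_def)

lemma append_left_quotient: "prefix u w \<Longrightarrow> u @ left_quotient u w = w"
  by (simp add: left_quotient_iff)

lemma transitionI:
  shows transition5: "Pair u [] \<in> Q1 A C \<phi> \<Longrightarrow> b \<in> B \<Longrightarrow> u = \<psi> [b] @ u' \<Longrightarrow>
      (Pair u [], ([], [b]), Pair u' []) \<in> transitions M"
    and transition6: "Pair u [] \<in> Q1 A C \<phi> \<Longrightarrow> b \<in> B \<Longrightarrow> \<psi> [b] = u @ v' \<Longrightarrow>
      (Pair u [], ([], [b]), Pair [] v') \<in> transitions M"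
    and transition7: "Pair [] v \<in> Q2 B C \<psi> \<Longrightarrow> a \<in> A \<Longrightarrow> v = \<phi> [a] @ v' \<Longrightarrow>
      (Pair [] v, ([a], []), Pair [] v') \<in> transitions M"
    and transition8: "Pair [] v \<in> Q2 B C \<psi> \<Longrightarrow> a \<in> A \<Longrightarrow> \<phi> [a] = v @ u' \<Longrightarrow>
      (Pair [] v, ([a], []), Pair u' []) \<in> transitions M"
  by (auto simp: transitions_M \<Delta>5_def \<Delta>6_def \<Delta>7_def \<Delta>8_def left_quotient_def Q1_def Q2_def)

lemma start_transitionI:
  shows transition1: "a \<in> A \<Longrightarrow> \<phi> [a] = [] \<Longrightarrow> (Start, ([a], []), Pair [] []) \<in> transitions M"
    and transition2: "b \<in> B \<Longrightarrow> \<psi> [b] = [] \<Longrightarrow> (Start, ([], [b]), Pair [] []) \<in> transitions M"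
    and transition3: "a \<in> A \<Longrightarrow> b \<in> B \<Longrightarrow> \<phi> [a] = \<psi> [b] @ u \<Longrightarrow> \<psi> [b] \<noteq> [] \<Longrightarrow>
      (Start, ([a], [b]), Pair u []) \<in> transitions M"
    and transition4: "a \<in> A \<Longrightarrow> b \<in> B \<Longrightarrow> \<psi> [b] = \<phi> [a] @ v \<Longrightarrow> \<phi> [a] \<noteq> [] \<Longrightarrow>
      (Start, ([a], [b]), Pair [] v) \<in> transitions M"
  by (auto simp: transitions_M \<Delta>1_def \<Delta>2_def \<Delta>3_def \<Delta>4_def left_quotient_def)

lemma pair_transition_cases:
  assumes "(Pair u v, (x, y), r) \<in> transitions M"
  obtains b u' where "v = []" "u \<noteq> []" "x = []" "y = [b]" "r = Pair u' []" "u = \<psi> [b] @ u'"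
  | b v' where "v = []" "u \<noteq> []" "x = []" "y = [b]" "r = Pair [] v'" "\<psi> [b] = u @ v'"
  | a v' where "u = []" "v \<noteq> []" "x = [a]" "y = []" "r = Pair [] v'" "v = \<phi> [a] @ v'"
  | a u' where "u = []" "v \<noteq> []" "x = [a]" "y = []" "r = Pair u' []" "\<phi> [a] = v @ u'"
proof -
  from assms consider "(Pair u v, (x, y), r) \<in> \<Delta>5 A B C \<phi> \<psi>"
    | "(Pair u v, (x, y), r) \<in> \<Delta>6 A B C \<phi> \<psi>"
    | "(Pair u v, (x, y), r) \<in> \<Delta>7 A B C \<phi> \<psi>"
    | "(Pair u v, (x, y), r) \<in> \<Delta>8 A B C \<phi> \<psi>"
    by (auto simp: transitions_M \<Delta>1_def \<Delta>2_def \<Delta>3_def \<Delta>4_def)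
  then show thesis
  proof cases
    case 1
    then obtain b where "v = []" "u \<noteq> []" "x = []" "y = [b]" "r = Pair (left_quotient (\<psi> [b]) u) []"
      and pre: "prefix (\<psi> [b]) u"
      unfolding \<Delta>5_def by blast
    then show ?thesis using that(1) append_left_quotient[OF pre, symmetric] by blast
  next
    case 2
    then obtain b where "v = []" "u \<noteq> []" "x = []" "y = [b]" "r = Pair [] (left_quotient u (\<psi> [b]))"
      and pre: "prefix u (\<psi> [b])"
      unfolding \<Delta>6_def by blast
    then show ?thesis using that(2) append_left_quotient[OF pre, symmetric] by blast
  next
    case 3
    then obtain a where "u = []" "v \<noteq> []" "x = [a]" "y = []" "r = Pair [] (left_quotient (\<phi> [a]) v)"
      and pre: "prefix (\<phi> [a]) v"
      unfolding \<Delta>7_def by blast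
    then show ?thesis using that(3) append_left_quotient[OF pre, symmetric] by blast
  next
    case 4
    then obtain a where "u = []" "v \<noteq> []" "x = [a]" "y = []" "r = Pair (left_quotient v (\<phi> [a])) []"
      and pre: "prefix v (\<phi> [a])"
      unfolding \<Delta>8_def by blast
    then show ?thesis using that(4) append_left_quotient[OF pre, symmetric] by blast
  qed
qed

lemma start_transition_cases:
  assumes "(Start, (x, y), r) \<in> transitions M"
  obtains a where "x = [a]" "y = []" "r = Pair [] []" "\<phi> [a] = []"
  | b where "x = []" "y = [b]" "r = Pair [] []" "\<psi> [b] = []"
  | a b u v where "x = [a]" "y = [b]" "r = Pair u v"
      "v = [] \<and> \<phi> [a] = \<psi> [b] @ u \<or> u = [] \<and> \<psi> [b] = \<phi> [a] @ v" "\<phi> [a] \<noteq> []" "\<psi> [b] \<noteq> []"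
proof -
  from assms consider "(Start, (x, y), r) \<in> \<Delta>1 A \<phi>" | "(Start, (x, y), r) \<in> \<Delta>2 B \<psi>"
    | "(Start, (x, y), r) \<in> \<Delta>3 A B \<phi> \<psi>" | "(Start, (x, y), r) \<in> \<Delta>4 A B \<phi> \<psi>"
    by (auto simp: transitions_M \<Delta>5_def \<Delta>6_def \<Delta>7_def \<Delta>8_def)
  then show thesis
  proof cases
    case 1
    then show ?thesis unfolding \<Delta>1_def using that(1) by blast
  next
    case 2
    then show ?thesis unfolding \<Delta>2_def using that(2) by blast
  next
    case 3
    then obtain a b where ab: "x = [a]" "y = [b]" "r = Pair (left_quotient (\<psi> [b]) (\<phi> [a])) []"
      "prefix (\<psi> [b]) (\<phi> [a])" "\<psi> [b] \<noteq> []"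
      unfolding \<Delta>3_def by blast
    then have "\<phi> [a] \<noteq> []" by auto
    then show ?thesis
      using that(3)[OF ab(1-3)] append_left_quotient[OF ab(4)] ab(5) by simp
  next
    case 4
    then obtain a b where ab: "x = [a]" "y = [b]" "r = Pair [] (left_quotient (\<phi> [a]) (\<psi> [b]))"
      "prefix (\<phi> [a]) (\<psi> [b])" "\<phi> [a] \<noteq> []"
      unfolding \<Delta>4_def by blast
    then have "\<psi> [b] \<noteq> []" by auto
    then show ?thesis
      using that(3)[OF ab(1-3)] append_left_quotient[OF ab(4)] ab(5) by simp
  qed
qed

lemma run_in_lists:
  assumes "run M p \<alpha> \<beta> q"
  shows "\<alpha> \<in> lists A \<and> \<beta> \<in> lists B"
  using assms
proof induction
  case (step p x y r \<alpha> \<beta> q)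
  have "(x, y) \<in> tape_labels A B" using transitions_subset step.hyps(1) by blast
  then show ?case using step.IH by (auto simp: tape_labels_def)
qed simp

lemma run_from_final:
  assumes "run M (Pair [] []) \<alpha> \<beta> q"
  shows "\<alpha> = []" "\<beta> = []"
  using assms final_no_transition by (auto elim: run.cases)


section \<open>Accepted labels are indecomposable\<close>

text \<open>Stated for \<open>Pair u v\<close> so that it is preserved by the transitions: each of them changes the
  overhang by exactly the image of the letter that is read.\<close>

lemma run_balanced:
  assumes "run M (Pair u v) \<alpha> \<beta> (Pair [] [])"
  shows "u @ letterwise \<phi> \<alpha> = v @ letterwise \<psi> \<beta>"
  using assms
proof (induction "Pair u v" \<alpha> \<beta> "Pair [] [] :: 'c state" arbitrary: u v rule: run.induct)
  case refl
  then show ?case by simp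
next
  case (step x y r \<alpha> \<beta>)
  from step.hyps(1) show ?case
    by (cases rule: pair_transition_cases) (use step.hyps(3) in auto)
qed

text \<open>No balanced cut lies strictly inside the run.  Such a cut has to make up for the nonempty
  overhang, so on the tape that lags behind it lies after the letter that the run reads next;
  hence it survives to the next state.  Once the overhang is empty, nothing is read any more.\<close>

lemma run_balanced_only_at_end:
  assumes "run M (Pair u v) (\<alpha>1 @ \<alpha>2) (\<beta>1 @ \<beta>2) (Pair [] [])"
    and "u @ letterwise \<phi> \<alpha>1 = v @ letterwise \<psi> \<beta>1"
  shows "\<alpha>2 = [] \<and> \<beta>2 = []"
  using assms
proof (induction "Pair u v" "\<alpha>1 @ \<alpha>2" "\<beta>1 @ \<beta>2" "Pair [] [] :: 'c state"
    arbitrary: u v \<alpha>1 \<beta>1 rule: run.induct)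
  case refl
  then show ?case by simp
next
  case (step x y r \<alpha> \<beta>)
  from step.hyps(1) show ?case
  proof (cases rule: pair_transition_cases)
    case (1 b u')
    with step.prems obtain \<beta>' where "\<beta>1 = b # \<beta>'"
      using step.hyps(5) by (cases \<beta>1) auto
    then show ?thesis using 1 step.hyps step.prems by auto
  next
    case (2 b v')
    with step.prems obtain \<beta>' where "\<beta>1 = b # \<beta>'"
      using step.hyps(5) by (cases \<beta>1) auto
    then show ?thesis using 2 step.hyps step.prems by auto
  next
    case (3 a v')
    with step.prems obtain \<alpha>' where "\<alpha>1 = a # \<alpha>'"
      using step.hyps(4) by (cases \<alpha>1) auto
    then show ?thesis using 3 step.hyps step.prems by auto
  next
    case (4 a u')
    with step.prems obtain \<alpha>' where "\<alpha>1 = a # \<alpha>'"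
      using step.hyps(4) by (cases \<alpha>1) auto
    then show ?thesis using 4 step.hyps step.prems by auto
  qed
qed

abbreviation accepted :: "('a list \<times> 'b list) set" where
  "accepted \<equiv> {(\<alpha>, \<beta>). run M Start \<alpha> \<beta> (Pair [] [])}"

lemma accepted_cases:
  assumes "(\<alpha>, \<beta>) \<in> accepted"
  obtains a where "\<alpha> = [a]" "\<beta> = []" "\<phi> [a] = []"
  | b where "\<alpha> = []" "\<beta> = [b]" "\<psi> [b] = []"
  | a \<alpha>' b \<beta>' u v where "\<alpha> = a # \<alpha>'" "\<beta> = b # \<beta>'" "run M (Pair u v) \<alpha>' \<beta>' (Pair [] [])"
      "v = [] \<and> \<phi> [a] = \<psi> [b] @ u \<or> u = [] \<and> \<psi> [b] = \<phi> [a] @ v" "\<phi> [a] \<noteq> []" "\<psi> [b] \<noteq> []"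
proof -
  from assms obtain x y r \<alpha>' \<beta>' where t: "(Start, (x, y), r) \<in> transitions M"
    and r: "run M r \<alpha>' \<beta>' (Pair [] [])" and ab: "\<alpha> = x @ \<alpha>'" "\<beta> = y @ \<beta>'"
    by (auto elim: run.cases)
  from t show thesis
  proof (cases rule: start_transition_cases)
    case (1 a)
    then show ?thesis using run_from_final r ab that(1) by simp
  next
    case (2 b)
    then show ?thesis using run_from_final r ab that(2) by simp
  next
    case (3 a b u v)
    then show ?thesis using that(3)[of a \<alpha>' b \<beta>' u v] r ab by simp
  qed
qed

text \<open>Beyond \<open>run_balanced_only_at_end\<close>, only the transition leaving \<^const>\<open>Start\<close> is to be examined:
  the ones that read a letter on both tapes apply to letters that are not erased.\<close>

theorem accepted_indecomposable:
  assumes "(\<alpha>, \<beta>) \<in> accepted"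
  shows "indecomposable P (\<alpha>, \<beta>)"
proof -
  have cut: "(\<alpha>1 = [] \<and> \<beta>1 = []) \<or> (\<alpha>2 = [] \<and> \<beta>2 = [])"
    if split: "\<alpha> = \<alpha>1 @ \<alpha>2" "\<beta> = \<beta>1 @ \<beta>2" and balanced: "letterwise \<phi> \<alpha>1 = letterwise \<psi> \<beta>1"
    for \<alpha>1 \<alpha>2 \<beta>1 \<beta>2
    using assms
  proof (cases rule: accepted_cases)
    case (1 a)
    then show ?thesis using split by (auto simp: append_eq_Cons_conv Cons_eq_append_conv)
  next
    case (2 b)
    then show ?thesis using split by (auto simp: append_eq_Cons_conv Cons_eq_append_conv)
  next
    case (3 a \<alpha>' b \<beta>' u v)
    show ?thesis
    proof (cases "\<alpha>1 = [] \<or> \<beta>1 = []")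
      case True
      \<comment> \<open>Neither of the first letters is erased, so a balanced cut reads both or none of them.\<close>
      then have "\<alpha>1 = [] \<and> \<beta>1 = []"
        using 3(1,2,5,6) split balanced by (auto simp: append_eq_Cons_conv Cons_eq_append_conv)
      then show ?thesis by blast
    next
      case False
      then obtain \<alpha>1' \<beta>1' where "\<alpha>1 = a # \<alpha>1'" "\<alpha>' = \<alpha>1' @ \<alpha>2" "\<beta>1 = b # \<beta>1'" "\<beta>' = \<beta>1' @ \<beta>2"
        using 3(1,2) split by (auto simp: append_eq_Cons_conv Cons_eq_append_conv)
      moreover from this have "u @ letterwise \<phi> \<alpha>1' = v @ letterwise \<psi> \<beta>1'"
        using 3(4) balanced by auto
      ultimately show ?thesis
        using 3(3) run_balanced_only_at_end by blast
    qed
  qed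
  show ?thesis
    unfolding indecomposable_def
  proof (intro conjI ballI impI)
    show "(\<alpha>, \<beta>) \<noteq> \<one>\<^bsub>P\<^esub>"
      using assms by (cases rule: accepted_cases) auto
    fix y z assume yz: "y \<in> carrier P" "z \<in> carrier P" "(\<alpha>, \<beta>) = y \<otimes>\<^bsub>P\<^esub> z"
    obtain \<alpha>1 \<beta>1 \<alpha>2 \<beta>2 where "y = (\<alpha>1, \<beta>1)" "z = (\<alpha>2, \<beta>2)" by fastforce
    then show "y = \<one>\<^bsub>P\<^esub> \<or> z = \<one>\<^bsub>P\<^esub>"
      using cut[of \<alpha>1 \<alpha>2 \<beta>1 \<beta>2] yz by (simp add: carrier_P)
  qed
qed


section \<open>Accepted labels generate the fiber product\<close>

lemma accepted_subset_carrier: "accepted \<subseteq> carrier P"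
proof clarify
  fix \<alpha> \<beta> assume run: "run M Start \<alpha> \<beta> (Pair [] [])"
  then have "(\<alpha>, \<beta>) \<in> accepted" by simp
  then have "letterwise \<phi> \<alpha> = letterwise \<psi> \<beta>"
  proof (cases rule: accepted_cases)
    case (3 a \<alpha>' b \<beta>' u v)
    then show ?thesis using run_balanced[OF 3(3)] by auto
  qed simp_all
  then show "(\<alpha>, \<beta>) \<in> carrier P"
    using run_in_lists[OF run] by (simp add: carrier_P)
qed

text \<open>Because the two images agree in the end, the overhang and the image of the next letter of the
  tape that lags behind are prefixes of the same word, hence comparable, and some transition
  reads that letter.\<close>

lemma run_until_balanced:
  assumes "\<alpha> \<in> lists A" "\<beta> \<in> lists B" "Pair u v \<in> states M"
    and "u @ letterwise \<phi> \<alpha> = v @ letterwise \<psi> \<beta>"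
  shows "\<exists>\<alpha>1 \<alpha>2 \<beta>1 \<beta>2. \<alpha> = \<alpha>1 @ \<alpha>2 \<and> \<beta> = \<beta>1 @ \<beta>2 \<and> run M (Pair u v) \<alpha>1 \<beta>1 (Pair [] [])"
  using assms
proof (induction "length \<alpha> + length \<beta>" arbitrary: \<alpha> \<beta> u v rule: less_induct)
  case less
  have continue: ?case
    if tr: "(Pair u v, (x, y), Pair u' v') \<in> transitions M"
      and rest: "\<alpha> = x @ \<alpha>'" "\<beta> = y @ \<beta>'" "u' @ letterwise \<phi> \<alpha>' = v' @ letterwise \<psi> \<beta>'"
    for x y u' v' \<alpha>' \<beta>'
  proof -
    have "x \<noteq> [] \<or> y \<noteq> []" using tr no_empty_label by blast
    then have "length \<alpha>' + length \<beta>' < length \<alpha> + length \<beta>" using rest(1,2) by auto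
    moreover have "\<alpha>' \<in> lists A" "\<beta>' \<in> lists B" using less.prems(1,2) rest(1,2) by auto
    moreover have "Pair u' v' \<in> states M" using tr transitions_subset by blast
    ultimately obtain \<alpha>1 \<alpha>2 \<beta>1 \<beta>2 where "\<alpha>' = \<alpha>1 @ \<alpha>2" "\<beta>' = \<beta>1 @ \<beta>2"
      "run M (Pair u' v') \<alpha>1 \<beta>1 (Pair [] [])"
      using less.hyps[of \<alpha>' \<beta>' u' v'] rest(3) by blast
    then have "\<alpha> = (x @ \<alpha>1) @ \<alpha>2" "\<beta> = (y @ \<beta>1) @ \<beta>2"
      "run M (Pair u v) (x @ \<alpha>1) (y @ \<beta>1) (Pair [] [])"
      using rest(1,2) run.step[OF tr] by auto
    then show ?case by blast
  qed
  from less.prems(3) show ?case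
  proof (cases rule: state_cases)
    case 1
    have "\<alpha> = [] @ \<alpha>" "\<beta> = [] @ \<beta>" "run M (Pair u v) [] [] (Pair [] [])"
      using 1 by (simp_all add: run.refl)
    then show ?thesis by blast
  next
    case 2
    then obtain b \<beta>' where \<beta>: "\<beta> = b # \<beta>'"
      using less.prems(4) by (cases \<beta>) auto
    then have "b \<in> B" using less.prems(2) by simp
    have "u @ letterwise \<phi> \<alpha> = \<psi> [b] @ letterwise \<psi> \<beta>'"
      using less.prems(4) 2 \<beta> by simp
    then obtain w where "u = \<psi> [b] @ w \<and> w @ letterwise \<phi> \<alpha> = letterwise \<psi> \<beta>'
        \<or> u @ w = \<psi> [b] \<and> letterwise \<phi> \<alpha> = w @ letterwise \<psi> \<beta>'"
      by (auto simp: append_eq_append_conv2)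
    then show ?thesis
    proof
      assume w: "u = \<psi> [b] @ w \<and> w @ letterwise \<phi> \<alpha> = letterwise \<psi> \<beta>'"
      then show ?thesis
        using continue[of "[]" "[b]" w "[]" \<alpha> \<beta>'] transition5[OF 2(3) \<open>b \<in> B\<close>] 2(1) \<beta> by simp
    next
      assume w: "u @ w = \<psi> [b] \<and> letterwise \<phi> \<alpha> = w @ letterwise \<psi> \<beta>'"
      then show ?thesis
        using continue[of "[]" "[b]" "[]" w \<alpha> \<beta>'] transition6[OF 2(3) \<open>b \<in> B\<close>] 2(1) \<beta> by simp
    qed
  next
    case 3
    then obtain a \<alpha>' where \<alpha>: "\<alpha> = a # \<alpha>'"
      using less.prems(4) by (cases \<alpha>) auto
    then have "a \<in> A" using less.prems(1) by simp
    have "v @ letterwise \<psi> \<beta> = \<phi> [a] @ letterwise \<phi> \<alpha>'"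
      using less.prems(4) 3 \<alpha> by simp
    then obtain w where "v = \<phi> [a] @ w \<and> w @ letterwise \<psi> \<beta> = letterwise \<phi> \<alpha>'
        \<or> v @ w = \<phi> [a] \<and> letterwise \<psi> \<beta> = w @ letterwise \<phi> \<alpha>'"
      by (auto simp: append_eq_append_conv2)
    then show ?thesis
    proof
      assume w: "v = \<phi> [a] @ w \<and> w @ letterwise \<psi> \<beta> = letterwise \<phi> \<alpha>'"
      then show ?thesis
        using continue[of "[a]" "[]" "[]" w \<alpha>' \<beta>] transition7[OF 3(3) \<open>a \<in> A\<close>] 3(1) \<alpha> by simp
    next
      assume w: "v @ w = \<phi> [a] \<and> letterwise \<psi> \<beta> = w @ letterwise \<phi> \<alpha>'"
      then show ?thesis
        using continue[of "[a]" "[]" w "[]" \<alpha>' \<beta>] transition8[OF 3(3) \<open>a \<in> A\<close>] 3(1) \<alpha> by simp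
    qed
  qed
qed

text \<open>An erased letter at the beginning of either word is an accepted label by itself.  If neither word
  begins with one, then both are nonempty, and the run starts by reading both first letters.\<close>

lemma accepted_factor:
  assumes "(\<alpha>, \<beta>) \<in> carrier P" "(\<alpha>, \<beta>) \<noteq> ([], [])"
  shows "\<exists>\<alpha>1 \<alpha>2 \<beta>1 \<beta>2. \<alpha> = \<alpha>1 @ \<alpha>2 \<and> \<beta> = \<beta>1 @ \<beta>2 \<and> (\<alpha>1, \<beta>1) \<in> accepted"
proof -
  have in_lists: "\<alpha> \<in> lists A" "\<beta> \<in> lists B" and eq: "letterwise \<phi> \<alpha> = letterwise \<psi> \<beta>"
    using assms(1) by (simp_all add: carrier_P)
  consider (erased1) a \<alpha>' where "\<alpha> = a # \<alpha>'" "\<phi> [a] = []"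
    | (erased2) b \<beta>' where "\<beta> = b # \<beta>'" "\<psi> [b] = []"
    | (both) a \<alpha>' b \<beta>' where "\<alpha> = a # \<alpha>'" "\<beta> = b # \<beta>'" "\<phi> [a] \<noteq> []" "\<psi> [b] \<noteq> []"
    using assms(2) eq by (cases \<alpha>; cases \<beta>) auto
  then show ?thesis
  proof cases
    case erased1
    then have "run M Start ([a] @ []) ([] @ []) (Pair [] [])"
      using in_lists by (intro run.step[OF transition1 run.refl]) auto
    then have "\<alpha> = [a] @ \<alpha>'" "\<beta> = [] @ \<beta>" "([a], []) \<in> accepted" using erased1 by simp_all
    then show ?thesis by blast
  next
    case erased2
    then have "run M Start ([] @ []) ([b] @ []) (Pair [] [])"
      using in_lists by (intro run.step[OF transition2 run.refl]) auto
    then have "\<alpha> = [] @ \<alpha>" "\<beta> = [b] @ \<beta>'" "([], [b]) \<in> accepted" using erased2 by simp_all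
    then show ?thesis by blast
  next
    case both
    then have ab: "a \<in> A" "b \<in> B" using in_lists by auto
    have "\<phi> [a] @ letterwise \<phi> \<alpha>' = \<psi> [b] @ letterwise \<psi> \<beta>'"
      using eq both by simp
    then obtain w where "\<phi> [a] = \<psi> [b] @ w \<and> w @ letterwise \<phi> \<alpha>' = letterwise \<psi> \<beta>'
        \<or> \<phi> [a] @ w = \<psi> [b] \<and> letterwise \<phi> \<alpha>' = w @ letterwise \<psi> \<beta>'"
      by (auto simp: append_eq_append_conv2)
    then obtain u v where tr: "(Start, ([a], [b]), Pair u v) \<in> transitions M"
      and uv: "u @ letterwise \<phi> \<alpha>' = v @ letterwise \<psi> \<beta>'"
      using transition3[OF ab, of w] transition4[OF ab, of w] both(3,4) by (metis append_Nil)
    have "Pair u v \<in> states M" using tr transitions_subset by blast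
    then obtain \<alpha>1 \<alpha>2 \<beta>1 \<beta>2 where "\<alpha>' = \<alpha>1 @ \<alpha>2" "\<beta>' = \<beta>1 @ \<beta>2"
      "run M (Pair u v) \<alpha>1 \<beta>1 (Pair [] [])"
      using run_until_balanced[of \<alpha>' \<beta>' u v] in_lists both(1,2) uv by auto
    then have "\<alpha> = ([a] @ \<alpha>1) @ \<alpha>2" "\<beta> = ([b] @ \<beta>1) @ \<beta>2" "([a] @ \<alpha>1, [b] @ \<beta>1) \<in> accepted"
      using run.step[OF tr] both(1,2) by auto
    then show ?thesis by blast
  qed
qed

text \<open>Induction on the total length: what remains after splitting off an accepted label is again
  balanced, by cancellation.\<close>

theorem fiber_product_generated_by_accepted: "submonoid_generated P accepted = carrier P"
proof
  interpret P: monoid P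
    using monoid_fiber_product[OF epi_\<phi> epi_\<psi>] .
  show "submonoid_generated P accepted \<subseteq> carrier P"
    using P.submonoid_generated_subset_carrier[OF accepted_subset_carrier] by blast
  have "(\<alpha>, \<beta>) \<in> submonoid_generated P accepted" if "(\<alpha>, \<beta>) \<in> carrier P" for \<alpha> \<beta>
    using that
  proof (induction "length \<alpha> + length \<beta>" arbitrary: \<alpha> \<beta> rule: less_induct)
    case less
    show ?case
    proof (cases "(\<alpha>, \<beta>) = ([], [])")
      case True
      then show ?thesis using submonoid_generated.one[of P accepted] by simp
    next
      case False
      then obtain \<alpha>1 \<alpha>2 \<beta>1 \<beta>2 where split: "\<alpha> = \<alpha>1 @ \<alpha>2" "\<beta> = \<beta>1 @ \<beta>2"
        and acc: "(\<alpha>1, \<beta>1) \<in> accepted"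
        using accepted_factor[OF less.prems] by blast
      have "(\<alpha>1, \<beta>1) \<noteq> ([], [])"
        using accepted_indecomposable[OF acc] by (simp add: indecomposable_def)
      then have "length \<alpha>2 + length \<beta>2 < length \<alpha> + length \<beta>" using split by auto
      moreover have "(\<alpha>1, \<beta>1) \<in> carrier P" using acc accepted_subset_carrier by blast
      then have "(\<alpha>2, \<beta>2) \<in> carrier P" using less.prems split by (simp add: carrier_P)
      ultimately have "(\<alpha>2, \<beta>2) \<in> submonoid_generated P accepted" by (rule less.hyps)
      from submonoid_generated.mult[OF submonoid_generated.incl[OF acc] this]
      show ?thesis using split by simp
    qed
  qed
  then show "carrier P \<subseteq> submonoid_generated P accepted" by auto
qed

corollary finitely_generated_iff_finite_accepted:
  "finitely_generated_monoid P \<longleftrightarrow> finite accepted"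
proof
  assume "finitely_generated_monoid P"
  then obtain S where S: "finite S" "S \<subseteq> carrier P" "submonoid_generated P S = carrier P"
    unfolding finitely_generated_monoid_def by blast
  interpret P: monoid P
    using monoid_fiber_product[OF epi_\<phi> epi_\<psi>] .
  have "x \<in> S" if "x \<in> accepted" for x
  proof (rule P.indecomposable_in_generators[OF S(2)])
    show "x \<in> submonoid_generated P S" using that accepted_subset_carrier S(3) by blast
    show "indecomposable P x"
      using that accepted_indecomposable[of "fst x" "snd x"] by simp
  qed
  then show "finite accepted" using S(1) by (meson finite_subset subsetI)
next
  assume "finite accepted"
  then show "finitely_generated_monoid P"
    unfolding finitely_generated_monoid_def
    by (intro exI[of _ accepted] conjI accepted_subset_carrier fiber_product_generated_by_accepted)
qed


section \<open>Cycles and the number of accepted labels\<close>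

text \<open>An overhang is consumed one letter at a time by letters whose image has length one.\<close>

lemma run_drop_left: "Pair (w @ u) [] \<in> states M \<Longrightarrow> \<exists>\<beta>. run M (Pair (w @ u) []) [] \<beta> (Pair u [])"
proof (induction w)
  case Nil
  show ?case by (auto intro: run.refl)
next
  case (Cons c w)
  from Cons.prems have Q: "Pair (c # w @ u) [] \<in> Q1 A C \<phi>"
    by (auto elim: state_cases)
  then have "c \<in> C" by (auto simp: Q1_def)
  then obtain b where b: "b \<in> B" "\<psi> [b] = [c]"
    using monoid_epi_letter_preimage[OF epi_\<psi>] by blast
  then have tr: "(Pair (c # w @ u) [], ([], [b]), Pair (w @ u) []) \<in> transitions M"
    by (intro transition5[OF Q]) auto
  then have "Pair (w @ u) [] \<in> states M" using transitions_subset by blast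
  then obtain \<beta> where "run M (Pair (w @ u) []) [] \<beta> (Pair u [])" using Cons.IH by blast
  from run.step[OF tr this] show ?case by auto
qed

lemma run_drop_right: "Pair [] (w @ v) \<in> states M \<Longrightarrow> \<exists>\<alpha>. run M (Pair [] (w @ v)) \<alpha> [] (Pair [] v)"
proof (induction w)
  case Nil
  show ?case by (auto intro: run.refl)
next
  case (Cons c w)
  from Cons.prems have Q: "Pair [] (c # w @ v) \<in> Q2 B C \<psi>"
    by (auto elim: state_cases)
  then have "c \<in> C" by (auto simp: Q2_def)
  then obtain a where a: "a \<in> A" "\<phi> [a] = [c]"
    using monoid_epi_letter_preimage[OF epi_\<phi>] by blast
  then have tr: "(Pair [] (c # w @ v), ([a], []), Pair [] (w @ v)) \<in> transitions M"
    by (intro transition7[OF Q]) auto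
  then have "Pair [] (w @ v) \<in> states M" using transitions_subset by blast
  then obtain \<alpha> where "run M (Pair [] (w @ v)) \<alpha> [] (Pair [] v)" using Cons.IH by blast
  from run.step[OF tr this] show ?case by auto
qed

lemma coaccessible:
  assumes "Pair u v \<in> states M"
  shows "\<exists>\<alpha> \<beta>. run M (Pair u v) \<alpha> \<beta> (Pair [] [])"
  using assms
proof (cases rule: state_cases)
  case 1
  then show ?thesis by (auto intro: run.refl)
next
  case 2
  then show ?thesis using run_drop_left[of u "[]"] assms by auto
next
  case 3
  then show ?thesis using run_drop_right[of v "[]"] assms by auto
qed

text \<open>If \<open>u\<close> is a proper suffix of \<open>\<phi> [a] = c # w @ u\<close>, a run starts with \<open>a\<close> and a letter mapped to
  \<open>c\<close>, and goes on by consuming \<open>w\<close>.\<close>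

lemma accessible:
  assumes "Pair u v \<in> states M" "(u, v) \<noteq> ([], [])"
  shows "\<exists>\<alpha> \<beta>. run M Start \<alpha> \<beta> (Pair u v)"
  using assms(1)
proof (cases rule: state_cases)
  case 1
  then show ?thesis using assms(2) by simp
next
  case 2
  then obtain a where a: "a \<in> A" "strict_suffix u (\<phi> [a])" by (auto simp: Q1_def)
  then obtain c w where cw: "\<phi> [a] = c # w @ u"
    by (auto simp: strict_suffix_def suffix_def) (metis append_Cons append_Nil neq_Nil_conv)
  have "\<phi> [a] \<in> lists C" using monoid_epi_in_lists[OF epi_\<phi>] a(1) by simp
  then have "c \<in> C" using cw by simp
  then obtain b where b: "b \<in> B" "\<psi> [b] = [c]"
    using monoid_epi_letter_preimage[OF epi_\<psi>] by blast
  have tr: "(Start, ([a], [b]), Pair (w @ u) []) \<in> transitions M"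
    using transition3[OF a(1) b(1)] cw b(2) by simp
  then have "Pair (w @ u) [] \<in> states M" using transitions_subset by blast
  then obtain \<beta> where "run M (Pair (w @ u) []) [] \<beta> (Pair u [])" using run_drop_left by blast
  from run.step[OF tr this] show ?thesis using 2(1) by blast
next
  case 3
  then obtain b where b: "b \<in> B" "strict_suffix v (\<psi> [b])" by (auto simp: Q2_def)
  then obtain c w where cw: "\<psi> [b] = c # w @ v"
    by (auto simp: strict_suffix_def suffix_def) (metis append_Cons append_Nil neq_Nil_conv)
  have "\<psi> [b] \<in> lists C" using monoid_epi_in_lists[OF epi_\<psi>] b(1) by simp
  then have "c \<in> C" using cw by simp
  then obtain a where a: "a \<in> A" "\<phi> [a] = [c]"
    using monoid_epi_letter_preimage[OF epi_\<phi>] by blast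
  have tr: "(Start, ([a], [b]), Pair [] (w @ v)) \<in> transitions M"
    using transition4[OF a(1) b(1)] cw a(2) by simp
  then have "Pair [] (w @ v) \<in> states M" using transitions_subset by blast
  then obtain \<alpha> where "run M (Pair [] (w @ v)) \<alpha> [] (Pair [] v)" using run_drop_right by blast
  from run.step[OF tr this] show ?thesis using 3(1) by blast
qed

theorem finite_accepted_iff_no_cycle: "finite accepted \<longleftrightarrow> \<not> has_cycle M"
proof
  assume "\<not> has_cycle M"
  then show "finite accepted" by (rule finite_labels_of_runs)
next
  assume fin: "finite accepted"
  show "\<not> has_cycle M"
  proof
    assume "has_cycle M"
    then obtain p where p: "(p, p) \<in> (edges M)\<^sup>+"
      by (auto simp: has_cycle_iff_not_acyclic acyclic_def)
    from tranclD2[OF p] obtain r \<sigma> where in_edge: "(r, \<sigma>, p) \<in> transitions M"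
      by (auto simp: edges_def)
    from tranclD[OF p] obtain q \<tau> where out_edge: "(p, \<tau>, q) \<in> transitions M"
      by (auto simp: edges_def)
    obtain u v where uv: "p = Pair u v" using transition_to_Pair[OF in_edge] by blast
    have "Pair u v \<in> states M" using in_edge transitions_subset uv by blast
    moreover have "(u, v) \<noteq> ([], [])" using out_edge final_no_transition[of \<tau> q] uv by auto
    ultimately obtain \<alpha>0 \<beta>0 \<alpha>2 \<beta>2 where ends:
      "run M Start \<alpha>0 \<beta>0 p" "run M p \<alpha>2 \<beta>2 (Pair [] [])"
      using accessible[of u v] coaccessible[of u v] uv by blast
    have long: "\<exists>x\<in>accepted. n \<le> length (fst x) + length (snd x)" for n
    proof -
      obtain \<alpha>1 \<beta>1 where loop: "run M p \<alpha>1 \<beta>1 p" and n: "n \<le> length \<alpha>1 + length \<beta>1"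
        using pump_cycle[OF no_empty_label p] by blast
      have "(\<alpha>0 @ \<alpha>1 @ \<alpha>2, \<beta>0 @ \<beta>1 @ \<beta>2) \<in> accepted"
        using run_trans[OF ends(1) run_trans[OF loop ends(2)]] by simp
      then show ?thesis using n by (intro bexI) auto
    qed
    obtain m where "\<And>x. x \<in> accepted \<Longrightarrow> length (fst x) + length (snd x) \<le> m"
      using finite_nat_set_iff_bounded_le[of "(\<lambda>x. length (fst x) + length (snd x)) ` accepted"] fin
      by blast
    then show False using long[of "Suc m"] by (meson not_less_eq_eq order_trans)
  qed
qed

end


section \<open>The criterion\<close>

theorem theorem5p6:
  fixes A :: "'a set" and B :: "'b set" and C :: "'c set"
    and \<phi> :: "'a list \<Rightarrow> 'c list" and \<psi> :: "'b list \<Rightarrow> 'c list"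
  assumes "finite A" and "finite B" and "finite C"
    and "\<phi> \<in> monoid_epi (free_monoid A) (free_monoid C)"
    and "\<psi> \<in> monoid_epi (free_monoid B) (free_monoid C)"
  shows "finitely_generated_monoid (fiber_product A B \<phi> \<psi>)
    \<longleftrightarrow> \<not> has_cycle (assoc_automaton A B C \<phi> \<psi>)"
proof -
  interpret epi_pair A B C \<phi> \<psi>
    using assms by unfold_locales
  show ?thesis
    using finitely_generated_iff_finite_accepted finite_accepted_iff_no_cycle by simp
qed

end
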